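(* Let $M$ be an Orlicz function satisfying the $\Delta_2^\infty$-condition. Then $(L_M)_U=\Delta(\ell_{M_{\bar\beta}})_{\bar\beta\in\mathcal B}$ with equivalent norms, where $\|a\|_{\Delta(\ell_{M_{\bar\beta}})}:=\sup_{\bar\beta\in\mathcal B}\|a\|_{\ell_{M_{\bar\beta}}}$. Moreover, the continuous embeddings $$\ell_{\Phi_M}\hookrightarrow(L_M)_U\hookrightarrow\ell_{p_M}$$ hold.
   Context: An Orlicz function is an increasing convex continuous $M:[0,\infty)\to[0,\infty)$ with $M(0)=0$, $M(t)\to\infty$, normalized by $M(1)=1$; $M\in\Delta_2^\infty$ means $\sup_{u\ge1}M(2u)/M(u)<\infty$. $L_M=L_M[0,1]$ (Lebesgue measure) has the Luxemburg norm $\|f\|_{L_M}:=\inf\{\lambda>0:\int_0^1M(|f|/\lambda)\le1\}$. For a Banach lattice $X$, $\mathfrak B_n(X)$ is the set of $n$-tuples of pairwise disjoint ($|x_i|\wedge|x_j|=0$) norm-one elements; $\|a\|_{X_U(n)}:=\sup\{\|\sum_{i=1}^na_ix_i\|_X:(x_i)\in\mathfrak B_n(X)\}$ for $a\in\mathbb R^n$, and $X_U$ is the space of real sequences with $\|a\|_{X_U}:=\sup_n\|(a_i)_{i=1}^n\|_{X_U(n)}<\infty$. $M_v(u):=M(uv)/M(v)$ for $u\ge0,v>0$. $\mathcal B$ is the set of sequences $\bar\beta=(\beta_k)_{k\ge1}$ of positive reals with $\sum_k1/M(\beta_k)\le1$. The Musielak–Orlicz space $\ell_{M_{\bar\beta}}$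 consists of sequences $a$ with $\|a\|_{\ell_{M_{\bar\beta}}}:=\inf\{\lambda>0:\sum_kM_{\beta_k}(|a_k|/\lambda)\le1\}<\infty$; $\Delta(\ell_{M_{\bar\beta}})_{\bar\beta\in\mathcal B}$ is the set of $a\in\bigcap_{\bar\beta}\ell_{M_{\bar\beta}}$ with finite $\sup_{\bar\beta\in\mathcal B}\|a\|_{\ell_{M_{\bar\beta}}}$. $\Phi_M(u):=\sup_{v\ge\max(1,1/u)}M(vu)/M(v)$, $u>0$ ($\Phi_M(0)=0$), and $\ell_{\Phi_M}$ is the sequence space with norm $\inf\{\lambda>0:\sum_k\Phi_M(|a_k|/\lambda)\le1\}$. $p_M:=\sup\{p\ge1:\exists C>0,\ M(uv)\le Cu^pM(v)\ \text{for all }0<u\le1,\ uv\ge1\}$. *)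

theory Defs
  imports "HOL-Analysis.Analysis"
begin

definition orlicz_function :: "(real \<Rightarrow> real) \<Rightarrow> bool" where
  "orlicz_function M \<longleftrightarrow> M 0 = 0 \<and> mono_on {0..} M \<and> convex_on {0..} M \<and>
     continuous_on {0..} M \<and> filterlim M at_top at_top \<and> M 1 = 1"

definition delta2_infty :: "(real \<Rightarrow> real) \<Rightarrow> bool" where
  "delta2_infty M \<longleftrightarrow> (\<exists>C. \<forall>u\<ge>1. M (2 * u) / M u \<le> C)"

abbreviation I01 :: "real measure" where
  "I01 \<equiv> lebesgue_on {0..1}"

text \<open>Luxemburg norm on L_M[0,1] (value \<infinity> if the function is not in L_M).\<close>
definition LM_norm :: "(real \<Rightarrow> real) \<Rightarrow> (real \<Rightarrow> real) \<Rightarrow> ennreal" where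
  "LM_norm M f = Inf {ennreal r | r. r > 0 \<and>
      (\<integral>\<^sup>+ t. ennreal (M (\<bar>f t\<bar> / r)) \<partial>I01) \<le> 1}"

definition disjoint_normalized_tuples :: "(real \<Rightarrow> real) \<Rightarrow> nat \<Rightarrow> (nat \<Rightarrow> real \<Rightarrow> real) set" where
  "disjoint_normalized_tuples M n = {x.
      (\<forall>i<n. x i \<in> borel_measurable I01 \<and> LM_norm M (x i) = 1) \<and>
      (\<forall>i<n. \<forall>j<n. i \<noteq> j \<longrightarrow> (AE t in I01. min \<bar>x i t\<bar> \<bar>x j t\<bar> = 0))}"

definition LMU_n_norm :: "(real \<Rightarrow> real) \<Rightarrow> nat \<Rightarrow> (nat \<Rightarrow> real) \<Rightarrow> ennreal" where
  "LMU_n_norm M n a = (SUP x \<in> disjoint_normalized_tuples M n.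
      LM_norm M (\<lambda>t. \<Sum>i<n. a i * x i t))"

text \<open>Norm of (L_M)_U (value \<infinity> iff the sequence is not in (L_M)_U).\<close>
definition LMU_norm :: "(real \<Rightarrow> real) \<Rightarrow> (nat \<Rightarrow> real) \<Rightarrow> ennreal" where
  "LMU_norm M a = (SUP n. LMU_n_norm M n a)"

text \<open>The set \<B> of sequences \<beta> of positive reals with \<Sum> 1/M(\<beta>_k) \<le> 1 (terms 1/M(\<beta>_k) finite).\<close>
definition beta_set :: "(real \<Rightarrow> real) \<Rightarrow> (nat \<Rightarrow> real) set" where
  "beta_set M = {\<beta>. (\<forall>k. 0 < \<beta> k \<and> 0 < M (\<beta> k)) \<and>
      summable (\<lambda>k. 1 / M (\<beta> k)) \<and> (\<Sum>k. 1 / M (\<beta> k)) \<le> 1}"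

definition Mv :: "(real \<Rightarrow> real) \<Rightarrow> real \<Rightarrow> real \<Rightarrow> real" where
  "Mv M v u = M (u * v) / M v"

definition MO_norm :: "(real \<Rightarrow> real) \<Rightarrow> (nat \<Rightarrow> real) \<Rightarrow> (nat \<Rightarrow> real) \<Rightarrow> ennreal" where
  "MO_norm M \<beta> a = Inf {ennreal r | r. r > 0 \<and>
      (\<Sum>k. ennreal (Mv M (\<beta> k) (\<bar>a k\<bar> / r))) \<le> 1}"

text \<open>Norm of \<Delta>(l_{M_\<beta>})_{\<beta>\<in>\<B>} (value \<infinity> iff the sequence is not in it).\<close>
definition Delta_norm :: "(real \<Rightarrow> real) \<Rightarrow> (nat \<Rightarrow> real) \<Rightarrow> ennreal" where
  "Delta_norm M a = (SUP \<beta> \<in> beta_set M. MO_norm M \<beta> a)"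

definition PhiM :: "(real \<Rightarrow> real) \<Rightarrow> real \<Rightarrow> ennreal" where
  "PhiM M u = (if u = 0 then 0 else
      (SUP v \<in> {max 1 (1 / u)..}. ennreal (M (v * u) / M v)))"

definition Phi_norm :: "(real \<Rightarrow> real) \<Rightarrow> (nat \<Rightarrow> real) \<Rightarrow> ennreal" where
  "Phi_norm M a = Inf {ennreal r | r. r > 0 \<and> (\<Sum>k. PhiM M (\<bar>a k\<bar> / r)) \<le> 1}"

definition pM :: "(real \<Rightarrow> real) \<Rightarrow> real" where
  "pM M = Sup {p. p \<ge> 1 \<and> (\<exists>C>0. \<forall>u v. 0 < u \<and> u \<le> 1 \<and> u * v \<ge> 1 \<longrightarrow>
                 M (u * v) \<le> C * u powr p * M v)}"

definition lp_norm :: "real \<Rightarrow> (nat \<Rightarrow> real) \<Rightarrow> ennreal" where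
  "lp_norm p a = (if summable (\<lambda>k. \<bar>a k\<bar> powr p)
      then ennreal ((\<Sum>k. \<bar>a k\<bar> powr p) powr (1 / p)) else \<infinity>)"

end

theory Submission
  imports Defs
begin

text \<open>
  A sequence \<open>\<beta>\<close> with \<open>\<Sum> 1 / M(\<beta>\<^sub>k) \<le> 1\<close> is realised by the disjoint functions
  \<open>\<beta>\<^sub>k 1\<^bsub>A\<^sub>k\<^esub>\<close> with \<open>|A\<^sub>k| = 1 / M(\<beta>\<^sub>k)\<close>. Conversely, the modular of \<open>u x\<close>
  is at most a constant times \<open>M\<^sub>v(u)\<close> for a single \<open>v\<close> with \<open>1 / M(v)\<close> bounded by (a multiple of)
  the measure of the support of \<open>x\<close>, so every disjoint tuple is dominated by one \<open>\<beta>\<close>.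
  The embedding of \<open>\<ell>\<^bsub>\<Phi>\<^esub>\<close> follows by separating the indices with \<open>u\<^sub>k \<beta>\<^sub>k \<ge> 1\<close> from the others,
  which contribute at most \<open>\<Sum> 1 / M(\<beta>\<^sub>k)\<close>. For the embedding into \<open>\<ell>\<^sub>p\<close> with \<open>p = p\<^sub>M\<close>, maximality of \<open>p\<close>
  gives, for every \<open>u \<le> 1\<close>, arbitrarily large \<open>v\<close> with \<open>M\<^sub>v(u) \<ge> u\<^sup>p / 2\<close>: a reverse inequality
  \<open>M(w v) \<le> w\<^sup>q M(v)\<close> for one \<open>w < 1\<close>, some \<open>q > p\<close> and all large \<open>v\<close> could be iterated to show that \<open>q\<close>
  is admissible in the definition of \<open>p\<^sub>M\<close>.
\<close>

section \<open>Norms as infima of admissible radii\<close>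

lemma Inf_ennreal_lessD:
  assumes "Inf {ennreal r |r. r > 0 \<and> P r} < ennreal s"
    and "\<And>r s. 0 < r \<Longrightarrow> r \<le> s \<Longrightarrow> P r \<Longrightarrow> P s"
  shows "P s"
proof -
  obtain r where "r > 0" "P r" "ennreal r < ennreal s"
    using assms(1) unfolding Inf_less_iff by blast
  then show ?thesis
    using assms(2)[of r s] by (simp add: ennreal_less_iff)
qed

text \<open>Lets norms be compared without knowing that the defining infima are attained: every
  radius \<open>s\<close> strictly above \<open>L\<close> satisfies its modular bound, and
  \<open>s\<close> may then decrease to \<open>L\<close>. An infinite \<open>L\<close> is harmless
  because \<open>C > 0\<close>.\<close>

lemma ennreal_le_multI:
  fixes C :: real and X L :: ennreal
  assumes "C > 0" and le: "\<And>s. s > 0 \<Longrightarrow> L < ennreal s \<Longrightarrow> X \<le> ennreal (C * s)"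
  shows "X \<le> ennreal C * L"
proof (cases L)
  case (real l)
  have "X \<le> ennreal (C * l) + ennreal e" if "e > 0" for e
  proof -
    have "X \<le> ennreal (C * (l + e / C))"
      using that real assms(1) by (intro le) (auto simp: ennreal_less_iff add_nonneg_pos)
    also have "C * (l + e / C) = C * l + e"
      using assms(1) by (simp add: field_simps)
    finally show ?thesis
      using real that assms(1) by simp
  qed
  then have "X \<le> ennreal (C * l)"
    by (rule ennreal_le_epsilon)
  then show ?thesis
    using real assms(1) by (simp add: ennreal_mult)
qed (use assms(1) in \<open>simp add: ennreal_mult_top\<close>)

section \<open>Elementary consequences of convexity\<close>

lemma orlicz_zero: "orlicz_function M \<Longrightarrow> M 0 = 0"
  and orlicz_one: "orlicz_function M \<Longrightarrow> M 1 = 1"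
  and orlicz_mono: "orlicz_function M \<Longrightarrow> 0 \<le> x \<Longrightarrow> x \<le> y \<Longrightarrow> M x \<le> M y"
  unfolding orlicz_function_def mono_on_def by auto

lemma orlicz_nonneg: "orlicz_function M \<Longrightarrow> 0 \<le> x \<Longrightarrow> 0 \<le> M x"
  using orlicz_mono[of M 0 x] orlicz_zero[of M] by simp

lemma orlicz_scale_le:
  assumes "orlicz_function M" "0 \<le> c" "c \<le> 1" "0 \<le> x"
  shows "M (c * x) \<le> c * M x"
proof -
  have "convex_on {0..} M"
    using assms(1) by (simp add: orlicz_function_def)
  from convex_onD[OF this, of c 0 x] show ?thesis
    using assms(2-) orlicz_zero[OF assms(1)] by simp
qed

lemma orlicz_scale_ge:
  assumes "orlicz_function M" "1 \<le> c" "0 \<le> x"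
  shows "c * M x \<le> M (c * x)"
  using orlicz_scale_le[OF assms(1), of "1 / c" "c * x"] assms by (simp add: field_simps)

text \<open>Monotonicity of \<open>M\<close> is only weak, and \<open>M\<close> may vanish near 0.
  Convexity together with \<open>M 0 = 0\<close> gives strict growth wherever \<open>M\<close> is
  positive, which is what lower bounds for norms rely on.\<close>

lemma orlicz_scale_le_cancel:
  assumes "orlicz_function M" "0 \<le> x" "0 < M x" "M (c * x) \<le> M x"
  shows "c \<le> 1"
proof (rule ccontr)
  assume "\<not> c \<le> 1"
  then have "1 * M x < c * M x"
    using assms by (intro mult_strict_right_mono) auto
  moreover have "c * M x \<le> M (c * x)"
    using assms \<open>\<not> c \<le> 1\<close> by (intro orlicz_scale_ge) auto
  ultimately show False
    using assms(4) by linarith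
qed

lemma orlicz_ge_self: "orlicz_function M \<Longrightarrow> 1 \<le> x \<Longrightarrow> x \<le> M x"
  using orlicz_scale_ge[of M x 1] orlicz_one[of M] by simp

lemma orlicz_le_one: "orlicz_function M \<Longrightarrow> 0 \<le> x \<Longrightarrow> x \<le> 1 \<Longrightarrow> M x \<le> 1"
  using orlicz_mono[of M x 1] orlicz_one[of M] by simp

lemma orlicz_surj:
  assumes "orlicz_function M" "0 < y"
  obtains h where "0 < h" "M h = y"
proof -
  have "y \<le> M (max 1 y)"
    using orlicz_ge_self[OF assms(1), of "max 1 y"] by simp
  moreover have "continuous_on {0..max 1 y} M"
    using assms(1) unfolding orlicz_function_def by (auto elim: continuous_on_subset)
  ultimately obtain h where "0 \<le> h" "M h = y"
    using IVT'[of M 0 y "max 1 y"] assms(2) orlicz_zero[OF assms(1)] by force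
  moreover have "h \<noteq> 0"
    using \<open>M h = y\<close> assms(2) orlicz_zero[OF assms(1)] by auto
  ultimately show thesis
    using that[of h] by simp
qed

lemma orlicz_measurable:
  assumes "orlicz_function M" and [measurable]: "f \<in> borel_measurable N"
  shows "(\<lambda>t. M \<bar>f t\<bar>) \<in> borel_measurable N"
proof -
  have "continuous_on {0..} M"
    using assms(1) by (simp add: orlicz_function_def)
  \<comment> \<open>Nothing is known about \<open>M\<close> on negative arguments, so measurability
    goes through an extension that is continuous on the whole line.\<close>
  then have "continuous_on UNIV (\<lambda>s. M (max 0 s))"
    by (rule continuous_on_compose2) (auto intro!: continuous_intros)
  then have [measurable]: "(\<lambda>s. M (max 0 s)) \<in> borel_measurable borel"
    by (rule borel_measurable_continuous_onI)
  have "(\<lambda>t. M (max 0 \<bar>f t\<bar>)) \<in> borel_measurable N"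
    by measurable
  then show ?thesis by simp
qed

section \<open>Admissible sequences and modular bounds at radii above the norm\<close>

lemma beta_setD:
  assumes "orlicz_function M" "\<beta> \<in> beta_set M"
  shows "1 \<le> M (\<beta> k)" "1 \<le> \<beta> k" "(\<Sum>i<n. 1 / M (\<beta> i)) \<le> 1"
proof -
  have pos: "0 < M (\<beta> i)" "0 < \<beta> i" for i
    using assms(2) by (auto simp: beta_set_def)
  have le: "(\<Sum>i\<in>I. 1 / M (\<beta> i)) \<le> 1" if "finite I" for I
    using sum_le_suminf[of "\<lambda>k. 1 / M (\<beta> k)" I] assms(2) that pos
    by (force simp: beta_set_def less_imp_le)
  show "1 \<le> M (\<beta> k)"
    using le[of "{k}"] pos[of k] by simp
  \<comment> \<open>On [0,1] convexity gives \<open>M x \<le> x\<close>, so a value of at least 1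
    forces an argument of at least 1.\<close>
  then show "1 \<le> \<beta> k"
    using orlicz_scale_le[OF assms(1), of "\<beta> k" 1] pos(2)[of k] orlicz_one[OF assms(1)]
    by (cases "\<beta> k \<le> 1") auto
  show "(\<Sum>i<n. 1 / M (\<beta> i)) \<le> 1"
    by (rule le) simp
qed

lemma MO_norm_lessD:
  assumes "orlicz_function M" "\<beta> \<in> beta_set M" "MO_norm M \<beta> a < ennreal s"
  shows "(\<Sum>k. ennreal (Mv M (\<beta> k) (\<bar>a k\<bar> / s))) \<le> 1"
  using assms(3) unfolding MO_norm_def
proof (rule Inf_ennreal_lessD)
  fix r s :: real
  assume "0 < r" "r \<le> s" and *: "(\<Sum>k. ennreal (Mv M (\<beta> k) (\<bar>a k\<bar> / r))) \<le> 1"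
  have "Mv M (\<beta> k) (\<bar>a k\<bar> / s) \<le> Mv M (\<beta> k) (\<bar>a k\<bar> / r)" for k
    unfolding Mv_def using beta_setD[OF assms(1,2), of k] \<open>0 < r\<close> \<open>r \<le> s\<close>
    by (intro divide_right_mono orlicz_mono[OF assms(1)] mult_right_mono divide_left_mono) auto
  then have "(\<Sum>k. ennreal (Mv M (\<beta> k) (\<bar>a k\<bar> / s))) \<le> (\<Sum>k. ennreal (Mv M (\<beta> k) (\<bar>a k\<bar> / r)))"
    by (intro suminf_le ennreal_leI) auto
  with * show "(\<Sum>k. ennreal (Mv M (\<beta> k) (\<bar>a k\<bar> / s))) \<le> 1"
    by order
qed

lemma LM_norm_lessD:
  assumes "orlicz_function M" "LM_norm M f < ennreal s"
  shows "(\<integral>\<^sup>+ t. ennreal (M (\<bar>f t\<bar> / s)) \<partial>I01) \<le> 1"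
  using assms(2) unfolding LM_norm_def
proof (rule Inf_ennreal_lessD)
  fix r s :: real
  assume "0 < r" "r \<le> s" and *: "(\<integral>\<^sup>+ t. ennreal (M (\<bar>f t\<bar> / r)) \<partial>I01) \<le> 1"
  have "(\<integral>\<^sup>+ t. ennreal (M (\<bar>f t\<bar> / s)) \<partial>I01) \<le> (\<integral>\<^sup>+ t. ennreal (M (\<bar>f t\<bar> / r)) \<partial>I01)"
    using \<open>0 < r\<close> \<open>r \<le> s\<close>
    by (intro nn_integral_mono ennreal_leI orlicz_mono[OF assms(1)] divide_left_mono) auto
  with * show "(\<integral>\<^sup>+ t. ennreal (M (\<bar>f t\<bar> / s)) \<partial>I01) \<le> 1"
    by order
qed

lemma Phi_norm_lessD:
  assumes "orlicz_function M" "Phi_norm M a < ennreal s"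
  shows "(\<Sum>k. PhiM M (\<bar>a k\<bar> / s)) \<le> 1"
  using assms(2) unfolding Phi_norm_def
proof (rule Inf_ennreal_lessD)
  fix r s :: real
  assume "0 < r" "r \<le> s" and *: "(\<Sum>k. PhiM M (\<bar>a k\<bar> / r)) \<le> 1"
  \<comment> \<open>A larger argument enlarges both the terms and the range of \<open>v\<close> over
    which the supremum is taken.\<close>
  have mono: "PhiM M u \<le> PhiM M w" if "0 \<le> u" "u \<le> w" for u w
  proof (cases "u = 0")
    case False
    have "ennreal (M (v * u) / M v) \<le> ennreal (M (v * w) / M v)" if "v \<ge> max 1 (1 / u)" for v
      using that \<open>0 \<le> u\<close> \<open>u \<le> w\<close> orlicz_nonneg[OF assms(1), of v]
      by (intro ennreal_leI divide_right_mono orlicz_mono[OF assms(1)] mult_left_mono) auto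
    moreover have "max 1 (1 / w) \<le> max 1 (1 / u)"
      using False that by (intro max.mono divide_left_mono) auto
    ultimately have "(SUP v \<in> {max 1 (1 / u)..}. ennreal (M (v * u) / M v)) \<le>
        (SUP v \<in> {max 1 (1 / w)..}. ennreal (M (v * w) / M v))"
      by (intro SUP_subset_mono) auto
    then show ?thesis
      using False that by (simp add: PhiM_def)
  qed (simp add: PhiM_def)
  have "(\<Sum>k. PhiM M (\<bar>a k\<bar> / s)) \<le> (\<Sum>k. PhiM M (\<bar>a k\<bar> / r))"
    using \<open>0 < r\<close> \<open>r \<le> s\<close> by (intro suminf_le mono divide_left_mono) auto
  with * show "(\<Sum>k. PhiM M (\<bar>a k\<bar> / s)) \<le> 1"
    by order
qed

text \<open>At almost every point at most one summand is non-zero, and \<open>M 0 = 0\<close>, so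
  the integrands agree. The tuple is finite, hence the exceptional null sets can be merged.\<close>

lemma nn_integral_modular_disjoint_sum:
  fixes n :: nat
  assumes M: "orlicz_function M" and [measurable]: "\<And>i. i < n \<Longrightarrow> g i \<in> borel_measurable N"
    and disj: "\<And>i j. i < n \<Longrightarrow> j < n \<Longrightarrow> i \<noteq> j \<Longrightarrow> AE t in N. g i t = 0 \<or> g j t = 0"
    and "r > 0"
  shows "(\<integral>\<^sup>+ t. ennreal (M (\<bar>\<Sum>i<n. g i t\<bar> / r)) \<partial>N) =
    (\<Sum>i<n. \<integral>\<^sup>+ t. ennreal (M (\<bar>g i t\<bar> / r)) \<partial>N)"
proof -
  note [simp] = orlicz_zero[OF M]
  have "AE t in N. \<forall>i\<in>{..<n}. \<forall>j\<in>{..<n}. i \<noteq> j \<longrightarrow> g i t = 0 \<or> g j t = 0"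
    using disj by (intro AE_finite_allI) auto
  then have "AE t in N. ennreal (M (\<bar>\<Sum>i<n. g i t\<bar> / r)) = (\<Sum>i<n. ennreal (M (\<bar>g i t\<bar> / r)))"
  proof (eventually_elim)
    case (elim t)
    show ?case
    proof (cases "\<forall>i<n. g i t = 0")
      case False
      then obtain k where "k < n" "g k t \<noteq> 0" by auto
      then have 0: "g i t = 0" if "i \<in> {..<n} - {k}" for i
        using elim that by blast
      have "(\<Sum>i<n. g i t) = (\<Sum>i\<in>{k}. g i t)"
        using 0 \<open>k < n\<close> by (intro sum.mono_neutral_right) auto
      moreover have "(\<Sum>i<n. ennreal (M (\<bar>g i t\<bar> / r))) = (\<Sum>i\<in>{k}. ennreal (M (\<bar>g i t\<bar> / r)))"
        using 0 \<open>k < n\<close> by (intro sum.mono_neutral_right) auto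
      ultimately show ?thesis by simp
    qed simp
  qed
  then have "(\<integral>\<^sup>+ t. ennreal (M (\<bar>\<Sum>i<n. g i t\<bar> / r)) \<partial>N) =
    (\<integral>\<^sup>+ t. (\<Sum>i<n. ennreal (M (\<bar>g i t\<bar> / r))) \<partial>N)"
    by (rule nn_integral_cong_AE)
  also have "\<dots> = (\<Sum>i<n. \<integral>\<^sup>+ t. ennreal (M (\<bar>g i t\<bar> / r)) \<partial>N)"
  proof (rule nn_integral_sum)
    fix i assume "i \<in> {..<n}"
    then have "(\<lambda>t. M \<bar>g i t / r\<bar>) \<in> borel_measurable N"
      by (intro orlicz_measurable[OF M]) auto
    then show "(\<lambda>t. ennreal (M (\<bar>g i t\<bar> / r))) \<in> borel_measurable N"
      using \<open>r > 0\<close> by simp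
  qed
  finally show ?thesis .
qed

section \<open>The embedding of the Orlicz sequence space of \<open>PhiM M\<close>\<close>

lemma Delta_norm_le_Phi_norm:
  assumes M: "orlicz_function M"
  shows "Delta_norm M a \<le> ennreal 2 * Phi_norm M a"
  unfolding Delta_norm_def
proof (intro SUP_least ennreal_le_multI)
  fix \<beta> s assume \<beta>: "\<beta> \<in> beta_set M" and s: "(0::real) < s" "Phi_norm M a < ennreal s"
  note b = beta_setD[OF M \<beta>]
  have *: "ennreal (Mv M (\<beta> k) u) \<le> PhiM M u + ennreal (1 / M (\<beta> k))" if "u \<ge> 0" for k u
  proof (cases "u * \<beta> k \<ge> 1")
    case True
    then have "u > 0" using that by (cases "u = 0") auto
    then have "\<beta> k \<in> {max 1 (1 / u)..}"
      using True b(2)[of k] by (auto simp: field_simps)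
    then have "ennreal (M (\<beta> k * u) / M (\<beta> k)) \<le> PhiM M u"
      unfolding PhiM_def using \<open>u > 0\<close> by (auto intro: SUP_upper2)
    then show ?thesis
      by (simp add: Mv_def mult.commute add_increasing2)
  next
    case False
    then have "M (u * \<beta> k) \<le> 1"
      using that b(2)[of k] by (intro orlicz_le_one[OF M]) auto
    then have "ennreal (Mv M (\<beta> k) u) \<le> ennreal (1 / M (\<beta> k))"
      unfolding Mv_def using b(1)[of k] by (intro ennreal_leI divide_right_mono) auto
    then show ?thesis
      by (simp add: add_increasing)
  qed
  \<comment> \<open>At radius \<open>s\<close> the two contributions are bounded by 1 each. Doubling
    the radius gains a factor 1/2 by convexity, which compensates for their total of 2.\<close>
  have "ennreal (Mv M (\<beta> k) (\<bar>a k\<bar> / (2 * s))) \<le>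
    ennreal (1 / 2) * (PhiM M (\<bar>a k\<bar> / s) + ennreal (1 / M (\<beta> k)))" for k
  proof -
    have "Mv M (\<beta> k) (\<bar>a k\<bar> / (2 * s)) \<le> 1 / 2 * Mv M (\<beta> k) (\<bar>a k\<bar> / s)"
      using orlicz_scale_le[OF M, of "1 / 2" "\<bar>a k\<bar> / s * \<beta> k"] s b[of k]
      by (simp add: Mv_def field_simps)
    then have "ennreal (Mv M (\<beta> k) (\<bar>a k\<bar> / (2 * s))) \<le> ennreal (1 / 2 * Mv M (\<beta> k) (\<bar>a k\<bar> / s))"
      by (rule ennreal_leI)
    also have "\<dots> = ennreal (1 / 2) * ennreal (Mv M (\<beta> k) (\<bar>a k\<bar> / s))"
      by (rule ennreal_mult') simp
    also have "\<dots> \<le> ennreal (1 / 2) * (PhiM M (\<bar>a k\<bar> / s) + ennreal (1 / M (\<beta> k)))"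
      using s by (intro mult_left_mono *) auto
    finally show ?thesis .
  qed
  then have "(\<Sum>k. ennreal (Mv M (\<beta> k) (\<bar>a k\<bar> / (2 * s)))) \<le>
    (\<Sum>k. ennreal (1 / 2) * (PhiM M (\<bar>a k\<bar> / s) + ennreal (1 / M (\<beta> k))))"
    by (intro suminf_le) auto
  also have "\<dots> = ennreal (1 / 2) * ((\<Sum>k. PhiM M (\<bar>a k\<bar> / s)) + (\<Sum>k. ennreal (1 / M (\<beta> k))))"
    by (simp add: suminf_add)
  also have "(\<Sum>k. ennreal (1 / M (\<beta> k))) = ennreal (\<Sum>k. 1 / M (\<beta> k))"
    using \<beta> by (intro suminf_ennreal2) (auto simp: beta_set_def less_imp_le)
  also have "ennreal (1 / 2) * ((\<Sum>k. PhiM M (\<bar>a k\<bar> / s)) + \<dots>) \<le> ennreal (1 / 2) * (1 + 1)"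
    using Phi_norm_lessD[OF M s(2)] \<beta>
    by (intro mult_left_mono add_mono) (auto simp: beta_set_def)
  also have "\<dots> = ennreal (1 / 2 * 2)"
    by (subst ennreal_mult) auto
  finally show "MO_norm M \<beta> a \<le> ennreal (2 * s)"
    unfolding MO_norm_def using s by (intro Inf_lower) auto
qed simp

section \<open>The exponent \<open>pM M\<close> and the embedding into the corresponding sequence
  space\<close>

lemma delta2_exponent_bound:
  assumes M: "orlicz_function M" and "delta2_infty M"
  shows "bdd_above {p. p \<ge> 1 \<and> (\<exists>C>0. \<forall>u v. 0 < u \<and> u \<le> 1 \<and> u * v \<ge> 1 \<longrightarrow>
                 M (u * v) \<le> C * u powr p * M v)}" (is "bdd_above ?S")
proof -
  obtain K where K: "\<And>u. u \<ge> 1 \<Longrightarrow> M (2 * u) / M u \<le> K"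
    using assms(2) unfolding delta2_infty_def by blast
  have M2: "M (2 * u) \<le> K * M u" if "u \<ge> 1" for u
    using K[OF that] orlicz_ge_self[OF M that] that by (simp add: field_simps)
  have Kpos: "K > 0"
    using M2[of 1] orlicz_ge_self[OF M, of 2] orlicz_one[OF M] by simp
  have pow: "M (2 ^ n) \<le> K ^ n" for n
  proof (induction n)
    case (Suc n)
    have "M (2 ^ Suc n) \<le> K * M (2 ^ n)"
      using M2[of "2 ^ n"] by simp
    also have "\<dots> \<le> K * K ^ n"
      using Suc Kpos by simp
    finally show ?case by simp
  qed (use orlicz_one[OF M] in simp)
  \<comment> \<open>Testing an admissible exponent at \<open>u = 1 / 2 ^ n\<close>,
    \<open>v = 2 ^ n\<close>, where \<open>u * v = 1\<close>, bounds all powers of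
    \<open>2 powr p / K\<close> by one constant; so this ratio cannot exceed 1.\<close>
  have "p \<le> log 2 K" if p: "p \<in> ?S" for p
  proof (rule ccontr)
    assume "\<not> p \<le> log 2 K"
    then have K2: "K < 2 powr p"
      using Kpos by (simp add: log_less_iff not_le)
    obtain C where C: "C > 0" "\<And>u v. 0 < u \<Longrightarrow> u \<le> 1 \<Longrightarrow> u * v \<ge> 1 \<Longrightarrow> M (u * v) \<le> C * u powr p * M v"
      using p by blast
    have "(2 powr p / K) ^ n \<le> C" for n
    proof -
      have "1 \<le> C * (1 / 2 ^ n) powr p * M (2 ^ n)"
        using C(2)[of "1 / 2 ^ n" "2 ^ n"] orlicz_one[OF M] by simp
      also have "(1 / 2 ^ n) powr p = 1 / (2 powr p) ^ n"
        by (simp add: powr_divide powr_powr powr_power flip: powr_realpow mult.commute)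
      also have "C * (1 / (2 powr p) ^ n) * M (2 ^ n) \<le> C * (1 / (2 powr p) ^ n) * K ^ n"
        using C(1) pow by (intro mult_left_mono) auto
      finally show ?thesis
        using Kpos by (simp add: power_divide field_simps)
    qed
    moreover obtain n where "C < (2 powr p / K) ^ n"
      using real_arch_pow[of "2 powr p / K" C] K2 Kpos by auto
    ultimately show False
      by (meson not_le)
  qed
  then show ?thesis
    by (rule bdd_aboveI)
qed


text \<open>A majorant with known sum 1 yields summability and the bound on the sum at once.\<close>

lemma beta_setI:
  assumes "\<And>k. 0 < \<beta> k" "\<And>k. 0 < M (\<beta> k)" "\<And>k. 1 / M (\<beta> k) \<le> b k" "b sums 1"
  shows "\<beta> \<in> beta_set M"
proof -
  have b: "summable b" "suminf b = 1"
    using assms(4) by (auto simp: sums_iff)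
  have "norm (1 / M (\<beta> k)) \<le> b k" for k
    using assms(2,3)[of k] by simp
  then have summ: "summable (\<lambda>k. 1 / M (\<beta> k))"
    by (intro summable_comparison_test'[OF b(1), of 0])
  have "(\<Sum>k. 1 / M (\<beta> k)) \<le> 1"
    using suminf_le[OF assms(3) summ b(1)] b(2) by simp
  then show ?thesis
    using assms(1,2) summ by (simp add: beta_set_def)
qed

text \<open>The inequality for the single ratio \<open>w\<close> is iterated along powers of
  \<open>w\<close>. Rounding \<open>u\<close> up to such a power costs at most
  \<open>w powr (- q)\<close>, and arguments \<open>u * v\<close> below the threshold
  \<open>V\<close> cost a further \<open>V powr q\<close>.\<close>

lemma lower_exponent_of_eventual_bound:
  assumes M: "orlicz_function M" and w: "0 < w" "w < 1" and "0 \<le> q" "1 \<le> V"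
    and step: "\<And>v. V \<le> v \<Longrightarrow> M (w * v) \<le> w powr q * M v"
    and u: "0 < u" "u \<le> 1" "1 \<le> u * v"
  shows "M (u * v) \<le> (V / w) powr q * u powr q * M v"
proof -
  \<comment> \<open>The points \<open>w ^ j * v\<close> decrease in \<open>j\<close>, so if the last
    one is at least \<open>V\<close>, each application of \<open>step\<close> takes place above the
    threshold.\<close>
  have iter: "M (w ^ k * v) \<le> (w ^ k) powr q * M v" if "V \<le> w ^ k * v" "0 < v" for k v
    using that
  proof (induction k)
    case (Suc k)
    have "w ^ Suc k * v \<le> w ^ k * v"
      using w Suc.prems by (intro mult_right_mono power_decreasing) auto
    then have V: "V \<le> w ^ k * v"
      using Suc.prems by simp
    have "M (w ^ Suc k * v) \<le> w powr q * M (w ^ k * v)"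
      using step[OF V] by (simp add: mult.assoc)
    also have "\<dots> \<le> w powr q * ((w ^ k) powr q * M v)"
      using Suc.IH V Suc.prems by (intro mult_left_mono) auto
    finally show ?case
      using w by (simp add: powr_mult mult.assoc)
  qed simp
  have large: "M (u * v) \<le> (u / w) powr q * M v" if "V \<le> u * v" "0 < u" "u \<le> 1" for u v
  proof -
    have "v > 0"
      using that \<open>1 \<le> V\<close> by (metis less_le_trans zero_less_mult_pos zero_less_one order_trans)
    obtain n where "w ^ n < u"
      using real_arch_pow_inv[of u w] \<open>0 < u\<close> w by blast
    \<comment> \<open>Minimality brackets \<open>u\<close>: since \<open>u \<le> 1\<close>,
      \<open>m\<close> is some \<open>Suc k\<close> with \<open>w ^ Suc k < u \<le> w ^ k\<close>,
      hence \<open>w ^ k < u / w\<close>.\<close>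
    define m where "m = (LEAST n. w ^ n < u)"
    have m: "w ^ m < u" "\<And>k. k < m \<Longrightarrow> u \<le> w ^ k"
      unfolding m_def using \<open>w ^ n < u\<close> by (auto intro: LeastI dest: not_less_Least simp: not_less)
    with that obtain k where k: "m = Suc k"
      by (cases m) auto
    have "u * v \<le> w ^ k * v"
      using m(2)[of k] k \<open>v > 0\<close> by (intro mult_right_mono) auto
    then have "M (u * v) \<le> M (w ^ k * v)"
      using that \<open>v > 0\<close> by (intro orlicz_mono[OF M]) auto
    also have "\<dots> \<le> (w ^ k) powr q * M v"
      using iter[of k v] that \<open>v > 0\<close> \<open>u * v \<le> w ^ k * v\<close> by simp
    also have "\<dots> \<le> (u / w) powr q * M v"
      using m(1) k w \<open>0 \<le> q\<close> \<open>v > 0\<close> that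
      by (intro mult_right_mono powr_mono2 orlicz_nonneg[OF M]) (auto simp: field_simps)
    finally show ?thesis .
  qed
  have v: "1 \<le> v" "0 \<le> M v"
  proof -
    have "0 < u * v" using u(3) by linarith
    then have "0 < v" using u(1) by (rule zero_less_mult_pos)
    then have "u * v \<le> 1 * v" using u(2) by (intro mult_right_mono) auto
    then show "1 \<le> v" using u(3) by linarith
    then show "0 \<le> M v" by (intro orlicz_nonneg[OF M]) simp
  qed
  have "M (u * v) \<le> (V * u / w) powr q * M v"
  proof (cases "V \<le> v")
    case True
    \<comment> \<open>The least factor \<open>t \<ge> u\<close> for which \<open>t * v\<close>
      reaches the threshold. Because \<open>1 \<le> u * v\<close>, it exceeds \<open>u\<close> by a
      factor of at most \<open>V\<close>.\<close>
    define t where "t = max u (V / v)"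
    have t: "V \<le> t * v" "0 < t" "t \<le> 1" "t \<le> V * u"
    proof -
      have "V / v * v \<le> t * v"
        using v by (intro mult_right_mono) (auto simp: t_def)
      then show "V \<le> t * v" using v by simp
      show "0 < t" "t \<le> 1" using True u v by (auto simp: t_def)
      have "u \<le> V * u" using \<open>1 \<le> V\<close> u by simp
      moreover have "V * 1 \<le> V * (u * v)"
        using \<open>1 \<le> V\<close> u by (intro mult_left_mono) auto
      then have "V / v \<le> V * u"
        using v by (simp add: divide_le_eq mult.assoc)
      ultimately show "t \<le> V * u" by (simp add: t_def)
    qed
    have "M (u * v) \<le> M (t * v)"
      using u v by (intro orlicz_mono[OF M] mult_right_mono) (auto simp: t_def)
    also have "\<dots> \<le> (t / w) powr q * M v"
      by (rule large) (use t in auto)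
    also have "\<dots> \<le> (V * u / w) powr q * M v"
      using t w v \<open>0 \<le> q\<close> by (intro mult_right_mono powr_mono2 divide_right_mono) auto
    finally show ?thesis .
  next
    case False
    \<comment> \<open>For \<open>v\<close> below the threshold the right-hand factor is already at
      least 1, and monotonicity of \<open>M\<close> suffices.\<close>
    have "1 \<le> V * u"
    proof -
      have "u * v \<le> u * V" using False u by (intro mult_left_mono) auto
      with u(3) have "1 \<le> u * V" by linarith
      then show ?thesis by (simp only: mult.commute)
    qed
    then have "1 \<le> V * u / w"
      using w by (simp add: field_simps)
    then have "1 \<le> (V * u / w) powr q"
      using \<open>0 \<le> q\<close> by (rule ge_one_powr_ge_zero)
    then have "1 * M v \<le> (V * u / w) powr q * M v"
      using v by (intro mult_right_mono) auto
    moreover have "M (u * v) \<le> M v"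
      using u v mult_right_mono[of u 1 v] by (intro orlicz_mono[OF M]) auto
    ultimately show ?thesis by simp
  qed
  also have "V * u / w = (V / w) * u" by simp
  also have "((V / w) * u) powr q = (V / w) powr q * u powr q"
    by (rule powr_mult)
  finally show ?thesis .
qed

text \<open>\<open>pM M\<close> is a supremum of reals, so an admissible exponent lies below it once
  the set is known to be bounded above; the growth condition supplies this.\<close>

lemma pM_ge:
  assumes M: "orlicz_function M" and \<Delta>: "delta2_infty M" and "1 \<le> q" "C > 0"
    and "\<And>u v. 0 < u \<Longrightarrow> u \<le> 1 \<Longrightarrow> 1 \<le> u * v \<Longrightarrow> M (u * v) \<le> C * u powr q * M v"
  shows "q \<le> pM M"
  unfolding pM_def using assms by (intro cSup_upper delta2_exponent_bound) auto

lemma pM_ge_1: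
  assumes M: "orlicz_function M" and \<Delta>: "delta2_infty M"
  shows "1 \<le> pM M"
proof (rule pM_ge[OF assms, of 1 1])
  fix u v :: real assume "0 < u" "u \<le> 1" "1 \<le> u * v"
  then have "0 \<le> v"
    by (metis less_le_trans less_le zero_less_mult_pos zero_less_one)
  with \<open>0 < u\<close> \<open>u \<le> 1\<close> show "M (u * v) \<le> 1 * u powr 1 * M v"
    using orlicz_scale_le[OF M, of u v] by simp
qed auto

text \<open>Only the failure of exponents above \<open>pM M\<close> is used. The freedom in
  \<open>V\<close> later allows one such \<open>v\<close> per coordinate, growing fast enough to
  form a member of \<open>beta_set M\<close>.\<close>

lemma powr_pM_le_frequently:
  assumes M: "orlicz_function M" and \<Delta>: "delta2_infty M" and u: "0 \<le> u" "u \<le> 1"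
  obtains v where "V \<le> v" "1 \<le> v" "u powr pM M * M v \<le> 2 * M (u * v)"
proof -
  consider "u = 0" | "u = 1" | "0 < u" "u < 1" using u by linarith
  then have "\<exists>v. V \<le> v \<and> 1 \<le> v \<and> u powr pM M * M v \<le> 2 * M (u * v)"
  proof cases
    case 1
    then show ?thesis
      using orlicz_zero[OF M] by (intro exI[of _ "max 1 V"]) simp
  next
    case 2
    then show ?thesis
      using orlicz_nonneg[OF M, of "max 1 V"] by (intro exI[of _ "max 1 V"]) simp
  next
    case 3
    \<comment> \<open>Chosen so that \<open>u powr q\<close> is exactly half of
      \<open>u powr pM M\<close>; the excess over \<open>pM M\<close> depends on \<open>u\<close>,
      but the loss is the factor 2 for every \<open>u\<close>.\<close>
    define q where "q = pM M + log u (1 / 2)"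
    have "0 < log u (1 / 2)"
      using 3 by (simp add: log_def ln_div divide_pos_neg)
    then have q: "pM M < q" "1 \<le> q"
      using pM_ge_1[OF M \<Delta>] by (auto simp: q_def)
    have uq: "u powr q = u powr pM M / 2"
      using 3 by (simp add: q_def powr_add)
    \<comment> \<open>Otherwise the reverse inequality with ratio \<open>w = u\<close> holds beyond
      \<open>max 1 V\<close> and makes \<open>q > pM M\<close> admissible.\<close>
    have "\<exists>v\<ge>max 1 V. u powr q * M v < M (u * v)"
    proof (rule ccontr)
      assume "\<not> ?thesis"
      then have "\<And>v. max 1 V \<le> v \<Longrightarrow> M (u * v) \<le> u powr q * M v"
        by (auto simp: not_less)
      then have "q \<le> pM M"
        using 3 q(2)
        by (intro pM_ge[OF M \<Delta>, of q "(max 1 V / u) powr q"]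
            lower_exponent_of_eventual_bound[OF M, of u q "max 1 V"]) auto
      with q(1) show False by simp
    qed
    then show ?thesis
      by (auto simp: uq)
  qed
  then show thesis using that by blast
qed

text \<open>Each coordinate receives its own \<open>\<beta> k\<close> from the frequent lower bound.
  For this one sequence the modular of \<open>a / s\<close> dominates half the sum of the powers
  \<open>u k powr p\<close>.\<close>

lemma lp_norm_pM_le_Delta_norm:
  assumes M: "orlicz_function M" and \<Delta>: "delta2_infty M"
  shows "lp_norm (pM M) a \<le> ennreal 2 * Delta_norm M a"
proof (rule ennreal_le_multI)
  fix s :: real assume s: "0 < s" "Delta_norm M a < ennreal s"
  define u where "u k = \<bar>a k\<bar> / s" for k
  define p where "p = pM M"
  have p: "1 \<le> p" unfolding p_def by (rule pM_ge_1[OF assms])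
  \<comment> \<open>Since \<open>M x \<ge> x\<close> for \<open>x \<ge> 1\<close>, the reciprocals
    are dominated by the geometric series with sum 1.\<close>
  have bet: "\<beta> \<in> beta_set M" if "\<And>k. 2 ^ Suc k \<le> \<beta> k" for \<beta>
  proof (rule beta_setI[OF _ _ _ power_half_series])
    fix k
    have "(1::real) \<le> 2 ^ Suc k" by (rule one_le_power) simp
    then have "1 \<le> \<beta> k" using that[of k] by linarith
    then show "0 < \<beta> k" by simp
    have *: "2 ^ Suc k \<le> M (\<beta> k)"
      using orlicz_ge_self[OF M \<open>1 \<le> \<beta> k\<close>] that[of k] by linarith
    then show "0 < M (\<beta> k)"
      by (rule less_le_trans[rotated]) simp
    show "1 / M (\<beta> k) \<le> (1 / 2) ^ Suc k"
      using * \<open>0 < M (\<beta> k)\<close> by (simp add: power_divide field_simps)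
  qed
  have le1: "(\<Sum>k. ennreal (Mv M (\<beta> k) (u k))) \<le> 1" if "\<beta> \<in> beta_set M" for \<beta>
    unfolding u_def
  proof (rule MO_norm_lessD[OF M that])
    show "MO_norm M \<beta> a < ennreal s"
      using SUP_upper[of \<beta> "beta_set M" "\<lambda>\<beta>. MO_norm M \<beta> a", OF that] s(2)
      unfolding Delta_norm_def by (rule le_less_trans)
  qed
  have u: "0 \<le> u k" "u k \<le> 1" for k
  proof -
    show "0 \<le> u k" using s by (simp add: u_def)
    \<comment> \<open>Any member of \<open>beta_set M\<close> would do here: a single term of its
      modular is at most 1, and this already forces \<open>u k \<le> 1\<close>.\<close>
    define \<beta> :: "nat \<Rightarrow> real" where "\<beta> = (\<lambda>k. 2 ^ Suc k)"
    have \<beta>: "\<beta> \<in> beta_set M" by (rule bet) (simp add: \<beta>_def)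
    note b = beta_setD[OF M \<beta>, of k]
    have "ennreal (Mv M (\<beta> k) (u k)) \<le> 1"
      using le1[OF \<beta>] sum_le_suminf[of "\<lambda>k. ennreal (Mv M (\<beta> k) (u k))" "{k}"]
      by (auto simp: summableI simp del: ennreal_le_1 intro: order_trans)
    then have "M (u k * \<beta> k) \<le> M (\<beta> k)"
      using b by (simp add: Mv_def)
    then show "u k \<le> 1"
      by (rule orlicz_scale_le_cancel[OF M, rotated -1]) (use b in auto)
  qed
  have "\<exists>v. 2 ^ Suc k \<le> v \<and> 1 \<le> v \<and> u k powr p * M v \<le> 2 * M (u k * v)" for k
    using powr_pM_le_frequently[OF assms u(1)[of k] u(2)[of k], of "2 ^ Suc k"] unfolding p_def by metis
  then obtain \<beta> where \<beta>: "\<And>k. 2 ^ Suc k \<le> \<beta> k" "\<And>k. 1 \<le> \<beta> k"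
    "\<And>k. u k powr p * M (\<beta> k) \<le> 2 * M (u k * \<beta> k)"
    by metis
  have B: "\<beta> \<in> beta_set M" using bet \<beta>(1) by blast
  have "ennreal (u k powr p) \<le> 2 * ennreal (Mv M (\<beta> k) (u k))" for k
  proof -
    have "u k powr p \<le> 2 * Mv M (\<beta> k) (u k)"
      using \<beta>(3)[of k] beta_setD(1)[OF M B, of k] by (simp add: Mv_def field_simps)
    then have "ennreal (u k powr p) \<le> ennreal (2 * Mv M (\<beta> k) (u k))"
      by (rule ennreal_leI)
    then show ?thesis by (simp add: ennreal_mult')
  qed
  then have "(\<Sum>k. ennreal (u k powr p)) \<le> (\<Sum>k. 2 * ennreal (Mv M (\<beta> k) (u k)))"
    by (intro suminf_le summableI)
  also have "\<dots> = 2 * (\<Sum>k. ennreal (Mv M (\<beta> k) (u k)))"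
    by simp
  also have "\<dots> \<le> 2 * 1"
    by (intro mult_left_mono le1 B) simp
  finally have sum2: "(\<Sum>k. ennreal (u k powr p)) \<le> ennreal 2" by simp
  then have summ: "summable (\<lambda>k. u k powr p)"
    by (intro summable_suminf_not_top) (auto simp: top_unique)
  have le2: "(\<Sum>k. u k powr p) \<le> 2"
  proof -
    have "ennreal (\<Sum>k. u k powr p) \<le> ennreal 2"
      using sum2 unfolding suminf_ennreal2[OF powr_ge_zero summ] .
    then show ?thesis by (subst (asm) ennreal_le_iff) auto
  qed
  have ak: "\<bar>a k\<bar> powr p = s powr p * u k powr p" for k
    using s u(1)[of k] by (simp add: u_def flip: powr_mult)
  have "((\<Sum>k. \<bar>a k\<bar> powr p)) powr (1 / p) = (s powr p * (\<Sum>k. u k powr p)) powr (1 / p)"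
    by (simp add: ak suminf_mult[OF summ])
  \<comment> \<open>Here \<open>2 \<le> 2 powr p\<close> because \<open>p \<ge> 1\<close>, so the
    root produces the constant 2 independently of \<open>p\<close>.\<close>
  also have "\<dots> \<le> (s powr p * 2 powr p) powr (1 / p)"
    using le2 p s powr_mono[of 1 p 2]
    by (intro powr_mono2 mult_left_mono mult_nonneg_nonneg suminf_nonneg summ) auto
  also have "\<dots> = 2 * s"
    using p s by (simp add: powr_powr flip: powr_mult)
  finally have "((\<Sum>k. \<bar>a k\<bar> powr p)) powr (1 / p) \<le> 2 * s" .
  moreover have "summable (\<lambda>k. \<bar>a k\<bar> powr p)"
    unfolding ak by (intro summable_mult summ)
  ultimately show "lp_norm (pM M) a \<le> ennreal (2 * s)"
    unfolding lp_norm_def p_def[symmetric] by (simp add: ennreal_leI)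
qed simp

section \<open>Two-sided comparison of the norms of disjoint tuples and of admissible
  sequences\<close>

lemma Delta_norm_le_LMU_norm:
  assumes M: "orlicz_function M"
  shows "Delta_norm M a \<le> LMU_norm M a"
proof -
  have "MO_norm M \<beta> a \<le> ennreal 1 * LMU_norm M a" if \<beta>: "\<beta> \<in> beta_set M" for \<beta>
  proof (rule ennreal_le_multI)
    fix s :: real assume s: "0 < s" "LMU_norm M a < ennreal s"
    note b = beta_setD[OF M \<beta>]
    have bpos: "0 < M (\<beta> k)" "0 < \<beta> k" for k
      using b(1,2)[of k] by linarith+
    \<comment> \<open>Consecutive half-open intervals of length \<open>1 / M (\<beta> k)\<close> are
      disjoint, and they fit into [0,1] exactly because the reciprocals sum to at most 1.\<close>
    define S where "S k = (\<Sum>i<k. 1 / M (\<beta> i))" for k :: nat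
    define A where "A k = {S k..<S (Suc k)}" for k
    define x where "x k t = \<beta> k * indicator (A k) t" for k and t :: real
    have S_mono: "S j \<le> S k" if "j \<le> k" for j k
      unfolding S_def using that b(1) by (intro sum_mono2) (auto intro: order_trans[of 0 1])
    have S01: "0 \<le> S k" "S k \<le> 1" for k
      using S_mono[of 0 k] b(3)[of k] by (auto simp: S_def)
    have A01: "A k \<subseteq> {0..1}" for k
      using S01(1)[of k] S01(2)[of "Suc k"] by (force simp: A_def)
    have A_meas: "A k \<in> sets I01" for k
      using A01[of k] by (auto simp: A_def sets_restrict_space_iff)
    have A_emeasure: "emeasure I01 (A k) = ennreal (1 / M (\<beta> k))" for k
    proof -
      have "emeasure I01 (A k) = emeasure lebesgue (A k)"
        using A01[of k] by (intro emeasure_restrict_space) auto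
      also have "\<dots> = ennreal (S (Suc k) - S k)"
        unfolding A_def using S_mono[of k "Suc k"] by simp
      finally show ?thesis by (simp add: S_def)
    qed
    have modular: "(\<integral>\<^sup>+ t. ennreal (M (\<bar>c * x k t\<bar> / r)) \<partial>I01) = ennreal (Mv M (\<beta> k) (\<bar>c\<bar> / r))"
      if "r > 0" for c r k
    proof -
      have "ennreal (M (\<bar>c * x k t\<bar> / r)) = ennreal (M (\<bar>c\<bar> / r * \<beta> k)) * indicator (A k) t" for t
        using bpos(2)[of k] orlicz_zero[OF M] by (simp add: x_def abs_mult indicator_def)
      then have "(\<integral>\<^sup>+ t. ennreal (M (\<bar>c * x k t\<bar> / r)) \<partial>I01) =
          ennreal (M (\<bar>c\<bar> / r * \<beta> k)) * ennreal (1 / M (\<beta> k))"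
        using A_meas[of k] A_emeasure[of k] by (simp add: nn_integral_cmult_indicator)
      also have "\<dots> = ennreal (Mv M (\<beta> k) (\<bar>c\<bar> / r))"
        using that bpos[of k]
        by (simp add: Mv_def less_imp_le orlicz_nonneg[OF M] flip: ennreal_mult)
      finally show ?thesis .
    qed
    \<comment> \<open>The modular of \<open>x k\<close> is 1 at radius 1, and any admissible radius
      is at least 1 by strict growth of \<open>M\<close> at \<open>\<beta> k\<close>.\<close>
    have norm1: "LM_norm M (x k) = 1" for k
    proof (rule antisym)
      have "ennreal 1 \<in> {ennreal r |r. r > 0 \<and> (\<integral>\<^sup>+ t. ennreal (M (\<bar>x k t\<bar> / r)) \<partial>I01) \<le> 1}"
        using modular[of 1 1 k] bpos[of k] by (auto simp: Mv_def)
      then show "LM_norm M (x k) \<le> 1"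
        unfolding LM_norm_def by (intro Inf_lower) simp
      show "1 \<le> LM_norm M (x k)"
        unfolding LM_norm_def
      proof (intro Inf_greatest, clarify)
        fix r :: real assume r: "0 < r" "(\<integral>\<^sup>+ t. ennreal (M (\<bar>x k t\<bar> / r)) \<partial>I01) \<le> 1"
        then have "M (1 / r * \<beta> k) \<le> M (\<beta> k)"
          using modular[of r 1 k] bpos[of k] by (simp add: Mv_def)
        then have "1 / r \<le> 1"
          by (rule orlicz_scale_le_cancel[OF M, rotated -1]) (use bpos[of k] in auto)
        then show "1 \<le> ennreal r"
          using r(1) by simp
      qed
    qed
    have disj: "x i t = 0 \<or> x j t = 0" if "i \<noteq> j" for i j t
      using that S_mono[of "Suc i" j] S_mono[of "Suc j" i]
      by (cases i j rule: linorder_cases) (auto simp: x_def A_def indicator_def)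
    have x_meas: "x k \<in> borel_measurable I01" for k
      unfolding x_def using A_meas[of k] by measurable
    \<comment> \<open>One infinite sequence serves for all \<open>n\<close>, since only its first
      \<open>n\<close> members are constrained. The partial sums of the series modular are then
      bounded uniformly in \<open>n\<close>.\<close>
    have tuple: "x \<in> disjoint_normalized_tuples M n" for n
    proof -
      have "min \<bar>x i t\<bar> \<bar>x j t\<bar> = 0" if "i \<noteq> j" for i j t
        using disj[OF that, of t] by auto
      then show ?thesis
        using x_meas norm1 by (simp add: disjoint_normalized_tuples_def)
    qed
    have "(\<Sum>k<n. ennreal (Mv M (\<beta> k) (\<bar>a k\<bar> / s))) \<le> 1" for n
    proof -
      have "LM_norm M (\<lambda>t. \<Sum>i<n. a i * x i t) \<le> LMU_norm M a"
        unfolding LMU_norm_def LMU_n_norm_def using tuple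
        by (intro SUP_upper2[of n UNIV] SUP_upper2[of x]) auto
      then have "LM_norm M (\<lambda>t. \<Sum>i<n. a i * x i t) < ennreal s"
        using s(2) by order
      then have "(\<integral>\<^sup>+ t. ennreal (M (\<bar>\<Sum>i<n. a i * x i t\<bar> / s)) \<partial>I01) \<le> 1"
        by (rule LM_norm_lessD[OF M])
      moreover have "(\<integral>\<^sup>+ t. ennreal (M (\<bar>\<Sum>i<n. a i * x i t\<bar> / s)) \<partial>I01) =
          (\<Sum>i<n. \<integral>\<^sup>+ t. ennreal (M (\<bar>a i * x i t\<bar> / s)) \<partial>I01)"
      proof (intro nn_integral_modular_disjoint_sum[OF M])
        fix i j :: nat assume "i \<noteq> j"
        then show "AE t in I01. a i * x i t = 0 \<or> a j * x j t = 0"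
          using disj[of i j] by (intro always_eventually) auto
      qed (use s(1) x_meas in auto)
      ultimately show ?thesis
        by (simp add: modular[OF s(1)])
    qed
    then have "(\<Sum>k. ennreal (Mv M (\<beta> k) (\<bar>a k\<bar> / s))) \<le> 1"
      unfolding suminf_eq_SUP by (rule SUP_least)
    then show "MO_norm M \<beta> a \<le> ennreal (1 * s)"
      unfolding MO_norm_def using s(1) by (intro Inf_lower) auto
  qed simp
  then show ?thesis
    unfolding Delta_norm_def by (intro SUP_least) simp
qed

text \<open>The part of the modular where \<open>\<bar>y\<bar> < h\<close> is controlled by the measure of the support,
  the part where \<open>\<bar>y\<bar> \<ge> h\<close> is an average of the values \<open>M\<^sub>v(u)\<close> with \<open>v \<ge> h\<close>.\<close>
lemma modular_le_Mv:
  assumes M: "orlicz_function M" and "finite_measure N" and y [measurable]: "y \<in> borel_measurable N"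
    and le1: "(\<integral>\<^sup>+ t. ennreal (M \<bar>y t\<bar>) \<partial>N) \<le> 1" and u: "0 \<le> u" "u \<le> 1"
    and h: "0 \<le> h" "0 < M h" "measure N {t \<in> space N. y t \<noteq> 0} * M h \<le> 4"
  obtains v where "h \<le> v" "(\<integral>\<^sup>+ t. ennreal (M (u * \<bar>y t\<bar>)) \<partial>N) \<le> ennreal (6 * Mv M v u)"
proof -
  interpret finite_measure N by fact
  let ?J = "\<integral>\<^sup>+ t. ennreal (M (u * \<bar>y t\<bar>)) \<partial>N"
  let ?Z = "{t \<in> space N. y t \<noteq> 0}"
  \<comment> \<open>The 5 splits as 4 from the support, where \<open>M h\<close> bounds the small
    values, plus 1 from the modular of \<open>y\<close>.\<close>
  have bound: "?J \<le> ennreal (5 * K)" if "K \<ge> 0" and K: "\<And>v. h \<le> v \<Longrightarrow> M (u * v) \<le> K * M v" for K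
  proof -
    have "M (u * \<bar>y t\<bar>) \<le> K * (M h * indicator ?Z t + M \<bar>y t\<bar>)" if "t \<in> space N" for t
    proof -
      consider "y t = 0" | "h \<le> \<bar>y t\<bar>" | "y t \<noteq> 0" "\<bar>y t\<bar> < h" by linarith
      then show ?thesis
      proof cases
        case 1
        then show ?thesis using orlicz_zero[OF M] by simp
      next
        case 2
        have "K * M \<bar>y t\<bar> \<le> K * (M h * indicator ?Z t + M \<bar>y t\<bar>)"
          using \<open>K \<ge> 0\<close> h(2) by (intro mult_left_mono) auto
        with K[OF 2] show ?thesis by linarith
      next
        case 3
        have "M (u * \<bar>y t\<bar>) \<le> M (u * h)"
          using u 3 by (intro orlicz_mono[OF M] mult_left_mono) auto
        also have "\<dots> \<le> K * M h" by (rule K) simp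
        also have "\<dots> \<le> K * (M h * indicator ?Z t + M \<bar>y t\<bar>)"
          using \<open>K \<ge> 0\<close> 3 that orlicz_nonneg[OF M, of "\<bar>y t\<bar>"] by (intro mult_left_mono) auto
        finally show ?thesis .
      qed
    qed
    then have "?J \<le> (\<integral>\<^sup>+ t. ennreal (K * (M h * indicator ?Z t + M \<bar>y t\<bar>)) \<partial>N)"
      by (intro nn_integral_mono ennreal_leI)
    also have "\<dots> = (\<integral>\<^sup>+ t. ennreal K * (ennreal (M h) * indicator ?Z t + ennreal (M \<bar>y t\<bar>)) \<partial>N)"
      using h(2) \<open>K \<ge> 0\<close> orlicz_nonneg[OF M]
      by (intro nn_integral_cong) (simp add: ennreal_mult' ennreal_plus indicator_def)
    also have "\<dots> = ennreal K * (ennreal (M h) * emeasure N ?Z + (\<integral>\<^sup>+ t. ennreal (M \<bar>y t\<bar>) \<partial>N))"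
      using orlicz_measurable[OF M y]
      by (simp add: nn_integral_cmult nn_integral_add nn_integral_cmult_indicator)
    also have "\<dots> \<le> ennreal K * (ennreal 4 + 1)"
    proof (intro mult_left_mono add_mono le1)
      show "ennreal (M h) * emeasure N ?Z \<le> ennreal 4"
        using h by (simp add: emeasure_eq_measure mult.commute ennreal_leI flip: ennreal_mult' ennreal_numeral)
    qed simp
    also have "\<dots> = ennreal (5 * K)"
      using \<open>K \<ge> 0\<close> by (simp add: ennreal_mult' mult.commute)
    finally show ?thesis .
  qed
  have nn: "0 \<le> M (u * v)" "0 < M v" if "h \<le> v" for v
    using that h u orlicz_mono[OF M h(1) that] by (auto intro!: orlicz_nonneg[OF M])
  \<comment> \<open>Finiteness of the integral comes first, so that a fraction of it can serve as
    \<open>K\<close> below.\<close>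
  have "?J \<le> ennreal (5 * 1)"
  proof (rule bound)
    fix v assume "h \<le> v"
    then show "M (u * v) \<le> 1 * M v"
      using orlicz_mono[OF M, of "u * v" v] u h(1) by (simp add: mult_left_le_one_le)
  qed simp
  then obtain J where J: "?J = ennreal J" "0 \<le> J"
    by (cases ?J) (auto simp: top_unique)
  \<comment> \<open>The gap between 5 and 6 replaces a supremum over \<open>v\<close> by a single
    \<open>v\<close>: otherwise \<open>K = J / 6\<close> is allowed, so
    \<open>J \<le> 5 * J / 6\<close> and \<open>J = 0\<close>, contradicting
    \<open>less\<close>.\<close>
  have "\<exists>v\<ge>h. J \<le> 6 * Mv M v u"
  proof (rule ccontr)
    assume neg: "\<not> (\<exists>v\<ge>h. J \<le> 6 * Mv M v u)"
    have less: "M (u * v) < J / 6 * M v" if "h \<le> v" for v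
    proof -
      have "\<not> J \<le> 6 * (M (u * v) / M v)"
        using neg that unfolding Mv_def by blast
      then show ?thesis
        using nn[OF that] by (simp add: field_simps not_le)
    qed
    have "?J \<le> ennreal (5 * (J / 6))"
      using J(2) by (intro bound) (auto intro: less_imp_le[OF less] simp del: times_divide_eq_left)
    then have "J = 0"
      using J by simp
    with less[of h] nn[of h] show False by simp
  qed
  then show thesis
    using that J by (auto intro: ennreal_leI)
qed

text \<open>The constant is \<open>12 = 2 * 6\<close>: the 2 passes from norm 1 to a modular bound
  at a strictly larger radius, and the 6 comes from \<open>modular_le_Mv\<close>.\<close>

lemma LMU_norm_le_Delta_norm:
  assumes M: "orlicz_function M"
  shows "LMU_norm M a \<le> ennreal 12 * Delta_norm M a"
  unfolding LMU_norm_def LMU_n_norm_def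
proof (intro SUP_least ennreal_le_multI)
  fix n x s
  assume x: "x \<in> disjoint_normalized_tuples M n" and s: "0 < s" "Delta_norm M a < ennreal s"
  interpret finite_measure I01
    by (rule finite_measureI) (simp add: emeasure_restrict_space)
  have x_meas [measurable]: "x i \<in> borel_measurable I01" if "i < n" for i
    using x that by (auto simp: disjoint_normalized_tuples_def)
  have x_norm: "LM_norm M (x i) = 1" if "i < n" for i
    using x that by (auto simp: disjoint_normalized_tuples_def)
  have x_disj: "AE t in I01. x i t = 0 \<or> x j t = 0" if "i < n" "j < n" "i \<noteq> j" for i j
  proof -
    have "AE t in I01. min \<bar>x i t\<bar> \<bar>x j t\<bar> = 0"
      using x that by (auto simp: disjoint_normalized_tuples_def)
    then show ?thesis
      by (rule AE_mp) (auto simp: min_def split: if_splits)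
  qed
  define Z where "Z i = {t \<in> space I01. x i t \<noteq> 0}" for i
  define m where "m i = measure I01 (Z i)" for i
  have m0: "0 \<le> m i" for i by (simp add: m_def)
  have Z: "Z i \<in> sets I01" if "i < n" for i
    unfolding Z_def using that by measurable
  have "(\<Sum>i<n. m i) = measure I01 (\<Union>i\<in>{..<n}. Z i)"
    unfolding m_def
  proof (rule measure_UNION_AE[symmetric])
    show "pairwise (\<lambda>i j. AE t in I01. t \<notin> Z i \<or> t \<notin> Z j) {..<n}"
      unfolding pairwise_def
    proof (intro ballI impI)
      fix i j assume "i \<in> {..<n}" "j \<in> {..<n}" "i \<noteq> j"
      then show "AE t in I01. t \<notin> Z i \<or> t \<notin> Z j"
        using x_disj[of i j] by (auto simp: Z_def elim: AE_mp)
    qed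
  qed (use Z in \<open>auto simp: fmeasurable_eq_sets\<close>)
  also have "\<dots> \<le> measure I01 (space I01)"
    by (rule bounded_measure)
  also have "\<dots> = 1"
    by (simp add: measure_restrict_space)
  finally have m1: "(\<Sum>i<n. m i) \<le> 1" .

  \<comment> \<open>The estimate is conditional on \<open>\<bar>a i\<bar> / s \<le> 1\<close>, which
    becomes available only after the sequence built from these \<open>v\<close> is known to be
    admissible (\<open>a1\<close> below).\<close>
  have ex: "\<exists>v. 0 < v \<and> 0 < M v \<and> 1 / M v \<le> (m i + 1 / n) / 4 \<and>
      (\<bar>a i\<bar> / s \<le> 1 \<longrightarrow>
        (\<integral>\<^sup>+ t. ennreal (M (\<bar>a i * x i t\<bar> / (2 * s))) \<partial>I01) \<le> ennreal (6 * Mv M v (\<bar>a i\<bar> / s)))"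
    if i: "i < n" for i
  proof -
    have pos: "0 < m i + 1 / n"
      using m0[of i] i by (simp add: add_nonneg_pos)
    \<comment> \<open>This height gives \<open>m i * M h \<le> 4\<close>. The summand
      \<open>1 / n\<close> keeps the weight positive, and since the \<open>m i\<close> sum to at
      most 1 the reciprocals \<open>1 / M (v i)\<close> use at most half of the allowed
      total.\<close>
    obtain h where h: "0 < h" "M h = 4 / (m i + 1 / n)"
      using orlicz_surj[OF M, of "4 / (m i + 1 / n)"] pos by auto
    have props: "0 < v \<and> 0 < M v \<and> 1 / M v \<le> (m i + 1 / n) / 4" if "h \<le> v" for v
    proof -
      have "M h \<le> M v" using h that by (intro orlicz_mono[OF M]) auto
      moreover have "0 < M h" using h pos by simp
      ultimately have "1 / M v \<le> 1 / M h" by (intro divide_left_mono) auto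
      then show ?thesis
        using h that less_le_trans[OF \<open>0 < M h\<close> \<open>M h \<le> M v\<close>] by auto
    qed
    show ?thesis
    proof (cases "\<bar>a i\<bar> / s \<le> 1")
      case True
      have "LM_norm M (x i) < ennreal 2"
        using x_norm[OF i] by simp
      then have le1: "(\<integral>\<^sup>+ t. ennreal (M \<bar>x i t / 2\<bar>) \<partial>I01) \<le> 1"
        using LM_norm_lessD[OF M] by fastforce
      have "m i * M h \<le> 4"
      proof -
        have "m i * M h \<le> (m i + 1 / n) * M h" using h pos by (intro mult_right_mono) auto
        also have "\<dots> = 4"
          using h(2) pos by (metis less_irrefl mult.commute nonzero_eq_divide_eq)
        finally show ?thesis .
      qed
      then have mh: "measure I01 {t \<in> space I01. x i t / 2 \<noteq> 0} * M h \<le> 4"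
        by (simp add: m_def Z_def)
      obtain v where "h \<le> v" and
        v: "(\<integral>\<^sup>+ t. ennreal (M (\<bar>a i\<bar> / s * \<bar>x i t / 2\<bar>)) \<partial>I01) \<le> ennreal (6 * Mv M v (\<bar>a i\<bar> / s))"
      proof (rule modular_le_Mv[OF M finite_measure_axioms _ le1, of "\<bar>a i\<bar> / s" h])
        show "(\<lambda>t. x i t / 2) \<in> borel_measurable I01"
          using i by measurable
      qed (use True s h pos mh in \<open>auto\<close>)
      then show ?thesis
        using props[OF \<open>h \<le> v\<close>] by (intro exI[of _ v]) (auto simp: abs_mult mult.commute)
    qed (use props[of h] in blast)
  qed
  obtain v where v: "\<And>i. i < n \<Longrightarrow> 0 < v i" "\<And>i. i < n \<Longrightarrow> 0 < M (v i)"
    "\<And>i. i < n \<Longrightarrow> 1 / M (v i) \<le> (m i + 1 / n) / 4"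
    "\<And>i. i < n \<Longrightarrow> \<bar>a i\<bar> / s \<le> 1 \<Longrightarrow>
      (\<integral>\<^sup>+ t. ennreal (M (\<bar>a i * x i t\<bar> / (2 * s))) \<partial>I01) \<le> ennreal (6 * Mv M (v i) (\<bar>a i\<bar> / s))"
    using ex by metis
  define \<beta> where "\<beta> k = (if k < n then v k else 2 ^ Suc (Suc k))" for k
  have tail: "2 ^ Suc (Suc k) \<le> M (2 ^ Suc (Suc k))" for k
    by (intro orlicz_ge_self[OF M] one_le_power) simp
  have tail_pos: "0 < M (2 ^ Suc (Suc k))" for k
    by (rule less_le_trans[OF _ tail]) simp
  define e where "e = 1 / 2 - (\<Sum>i<n. (m i + 1 / n) / 4)"
  have e: "0 \<le> e"
    using m1 by (cases "n = 0") (auto simp: e_def sum.distrib add_divide_distrib simp flip: sum_divide_distrib)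
  define b where "b k = (if k \<in> {..<n} then (m k + 1 / n) / 4 else 0) + (if k = 0 then e else 0)
      + (1 / 2) ^ Suc k * (1 / 2)" for k
  have \<beta>: "\<beta> \<in> beta_set M"
  proof (rule beta_setI[of _ _ b])
    have "b sums ((\<Sum>k<n. (m k + 1 / n) / 4) + e + 1 * (1 / 2))"
      unfolding b_def by (intro sums_add sums_mult2 power_half_series sums_If_finite_set sums_single) auto
    then show "b sums 1"
      by (simp add: e_def)
    fix k
    show "0 < \<beta> k" "0 < M (\<beta> k)"
      using v tail_pos by (auto simp: \<beta>_def)
    show "1 / M (\<beta> k) \<le> b k"
    proof (cases "k < n")
      case True
      then show ?thesis
        using v(3)[of k] e by (simp add: \<beta>_def b_def add_increasing2)
    next
      case False
      have "1 / M (2 ^ Suc (Suc k)) \<le> 1 / 2 ^ Suc (Suc k)"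
        using tail[of k] tail_pos[of k] by (intro divide_left_mono) auto
      also have "\<dots> = (1 / 2) ^ Suc k * (1 / 2)"
        by (simp add: power_divide)
      also have "\<dots> \<le> b k"
        using False e by (simp add: b_def)
      finally show ?thesis
        using False by (simp add: \<beta>_def)
    qed
  qed
  note \<beta>_ge = beta_setD(1,2)[OF M \<beta>]
  have le1: "(\<Sum>k. ennreal (Mv M (\<beta> k) (\<bar>a k\<bar> / s))) \<le> 1"
  proof (rule MO_norm_lessD[OF M \<beta>])
    show "MO_norm M \<beta> a < ennreal s"
      using SUP_upper[of \<beta> "beta_set M" "\<lambda>\<beta>. MO_norm M \<beta> a", OF \<beta>] s(2)
      unfolding Delta_norm_def by (rule le_less_trans)
  qed
  have a1: "\<bar>a k\<bar> / s \<le> 1" for k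
  proof -
    have "ennreal (Mv M (\<beta> k) (\<bar>a k\<bar> / s)) \<le> 1"
      using le1 sum_le_suminf[of "\<lambda>k. ennreal (Mv M (\<beta> k) (\<bar>a k\<bar> / s))" "{k}"]
      by (auto simp: summableI simp del: ennreal_le_1 intro: order_trans)
    then have "M (\<bar>a k\<bar> / s * \<beta> k) \<le> M (\<beta> k)"
      using \<beta>_ge(1)[of k] by (simp add: Mv_def)
    then show ?thesis
      by (rule orlicz_scale_le_cancel[OF M, rotated -1]) (use \<beta>_ge[of k] in auto)
  qed
  have "(\<integral>\<^sup>+ t. ennreal (M (\<bar>\<Sum>i<n. a i * x i t\<bar> / (2 * s))) \<partial>I01) =
      (\<Sum>i<n. \<integral>\<^sup>+ t. ennreal (M (\<bar>a i * x i t\<bar> / (2 * s))) \<partial>I01)"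
  proof (rule nn_integral_modular_disjoint_sum[OF M])
    fix i j assume "i < n" "j < n" "i \<noteq> j"
    from x_disj[OF this] show "AE t in I01. a i * x i t = 0 \<or> a j * x j t = 0"
      by (rule AE_mp) auto
  qed (use s x_meas in auto)
  also have "\<dots> \<le> (\<Sum>i<n. 6 * ennreal (Mv M (\<beta> i) (\<bar>a i\<bar> / s)))"
  proof (rule sum_mono)
    fix i assume "i \<in> {..<n}"
    then have "i < n" by simp
    from v(4)[OF this a1] this
    show "(\<integral>\<^sup>+ t. ennreal (M (\<bar>a i * x i t\<bar> / (2 * s))) \<partial>I01) \<le> 6 * ennreal (Mv M (\<beta> i) (\<bar>a i\<bar> / s))"
      by (simp add: \<beta>_def ennreal_mult')
  qed
  also have "\<dots> = 6 * (\<Sum>i<n. ennreal (Mv M (\<beta> i) (\<bar>a i\<bar> / s)))"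
    by (simp add: sum_distrib_left)
  also have "\<dots> \<le> 6 * 1"
    using le1 sum_le_suminf[of "\<lambda>k. ennreal (Mv M (\<beta> k) (\<bar>a k\<bar> / s))" "{..<n}"]
    by (intro mult_left_mono) (auto simp: summableI intro: order_trans)
  finally have le6: "(\<integral>\<^sup>+ t. ennreal (M (\<bar>\<Sum>i<n. a i * x i t\<bar> / (2 * s))) \<partial>I01) \<le> 6"
    by simp
  let ?f = "\<lambda>t. \<Sum>i<n. a i * x i t"
  have "(\<lambda>t. M \<bar>?f t / (2 * s)\<bar>) \<in> borel_measurable I01"
    by (intro orlicz_measurable[OF M]) measurable
  then have f_meas: "(\<lambda>t. M (\<bar>?f t\<bar> / (2 * s))) \<in> borel_measurable I01"
    using s by simp
  \<comment> \<open>Convexity turns the modular bound 6 at radius \<open>2 * s\<close> into 1 at six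
    times that radius.\<close>
  have "(\<integral>\<^sup>+ t. ennreal (M (\<bar>?f t\<bar> / (12 * s))) \<partial>I01) \<le>
      (\<integral>\<^sup>+ t. ennreal (1 / 6) * ennreal (M (\<bar>?f t\<bar> / (2 * s))) \<partial>I01)"
  proof (rule nn_integral_mono)
    fix t
    have "M (\<bar>?f t\<bar> / (12 * s)) \<le> 1 / 6 * M (\<bar>?f t\<bar> / (2 * s))"
      using orlicz_scale_le[OF M, of "1 / 6" "\<bar>?f t\<bar> / (2 * s)"] s by simp
    then have "ennreal (M (\<bar>?f t\<bar> / (12 * s))) \<le> ennreal (1 / 6 * M (\<bar>?f t\<bar> / (2 * s)))"
      by (rule ennreal_leI)
    then show "ennreal (M (\<bar>?f t\<bar> / (12 * s))) \<le> ennreal (1 / 6) * ennreal (M (\<bar>?f t\<bar> / (2 * s)))"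
      by (subst (asm) ennreal_mult') auto
  qed
  also have "\<dots> = ennreal (1 / 6) * (\<integral>\<^sup>+ t. ennreal (M (\<bar>?f t\<bar> / (2 * s))) \<partial>I01)"
    using f_meas by (intro nn_integral_cmult) measurable
  also have "\<dots> \<le> ennreal (1 / 6) * ennreal 6"
    using le6 by (intro mult_left_mono) auto
  also have "\<dots> = 1"
    by (subst ennreal_mult[symmetric]) auto
  finally show "LM_norm M (\<lambda>t. \<Sum>i<n. a i * x i t) \<le> ennreal (12 * s)"
    unfolding LM_norm_def using s by (intro Inf_lower) auto
qed simp

section \<open>Combination of the three norm inequalities\<close>

theorem mainTheorem18:
  fixes M :: "real \<Rightarrow> real"
  assumes "orlicz_function M" and "delta2_infty M"
  shows "(\<exists>c C :: real. 0 < c \<and> 0 < C \<and>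
            (\<forall>a. ennreal c * Delta_norm M a \<le> LMU_norm M a \<and>
                 LMU_norm M a \<le> ennreal C * Delta_norm M a))
       \<and> (\<exists>C :: real. 0 < C \<and> (\<forall>a. LMU_norm M a \<le> ennreal C * Phi_norm M a))
       \<and> (\<exists>C :: real. 0 < C \<and> (\<forall>a. lp_norm (pM M) a \<le> ennreal C * LMU_norm M a))"
proof (intro conjI)
  note Delta_LMU = Delta_norm_le_LMU_norm[OF assms(1)] and LMU_Delta = LMU_norm_le_Delta_norm[OF assms(1)]
  show "\<exists>c C :: real. 0 < c \<and> 0 < C \<and>
      (\<forall>a. ennreal c * Delta_norm M a \<le> LMU_norm M a \<and> LMU_norm M a \<le> ennreal C * Delta_norm M a)"
    using Delta_LMU LMU_Delta by (intro exI[of _ 1] exI[of _ 12]) auto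
  have "LMU_norm M a \<le> ennreal 24 * Phi_norm M a" for a
  proof -
    have "LMU_norm M a \<le> ennreal 12 * (ennreal 2 * Phi_norm M a)"
      using LMU_Delta Delta_norm_le_Phi_norm[OF assms(1)] by (rule order_trans[OF _ mult_left_mono]) auto
    also have "\<dots> = ennreal (12 * 2) * Phi_norm M a"
      by (subst ennreal_mult) (auto simp: mult.assoc)
    finally show ?thesis by simp
  qed
  then show "\<exists>C :: real. 0 < C \<and> (\<forall>a. LMU_norm M a \<le> ennreal C * Phi_norm M a)"
    by (intro exI[of _ 24]) auto
  have "lp_norm (pM M) a \<le> ennreal 2 * LMU_norm M a" for a
    using lp_norm_pM_le_Delta_norm[OF assms] Delta_LMU by (rule order_trans[OF _ mult_left_mono]) auto
  then show "\<exists>C :: real. 0 < C \<and> (\<forall>a. lp_norm (pM M) a \<le> ennreal C * LMU_norm M a)"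
    by (intro exI[of _ 2]) auto
qed

end
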